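(* Let $\mathbb{F}_q$ be a finite field of characteristic $p$, and let $f,g\in\mathbb{F}_q[x]$ be polynomials of degrees $k\ge 1$ and $D\ge 2$, respectively, such that the pair $(f,g)$ is neither critical nor $p$-critical. Then $M_{f,g}(n)\gg n$. Moreover, the following are equivalent: (i) there exists a constant $c>0$ such that $m_{f,g}(n)\le c$ for any $n\ge 0$; (ii) the sequence $m_{f,g}(n)$ is eventually constant; (iii) $f$ has a root $\beta\in\overline{\mathbb{F}}_q$ such that $g^{(i)}(\beta)=\beta$ for some $i\ge 1$.
   Context: For a polynomial $g$, put $g^{(0)}(x)=x$ and $g^{(n)}(x)=g(g^{(n-1)}(x))$ for $n\ge1$. For $f,g\in\mathbb{F}_q[x]$ and $n\ge 0$ put $P_n[f,g](x)=f(g^{(n)}(x))$. $M_{f,g}(n)$ (resp. $m_{f,g}(n)$) is the largest (resp. smallest) degree of an irreducible factor of $P_n[f,g](x)$ over $\mathbb{F}_q$. $\overline{\mathbb{F}}_q$ is the algebraic closure of $\mathbb{F}_q$. The pair $(f,g)$ is $p$-critical if $g(x)=ax^{p^h}+b$ for some $h\ge0$ and $a,b\in\mathbb{F}_q$. The pair $(f,g)$, with $k=\deg f$ and $D=\deg g$, is critical if there exist $\alpha,\beta,\gamma\in\mathbb{F}_q$ such that $f(x)=\beta(x-\alpha)^k$ and $g(x)=\gamma(x-\alpha)^D+\alpha$. For positive-valued functions $A,B$ of a positive integer $n$, $A\gg B$ means that there is a constant $c>0$ with $A(n)\ge c\,B(n)$ for all $n$. *)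

theory Defs
  imports
    Complex_Main
    "HOL-Algebra.Algebraic_Closure_Type"
    "HOL-Computational_Algebra.Computational_Algebra"
begin

text \<open>
  HOL-Algebra declares constants with the same base names as the polynomial library, so
  \<open>degree\<close>, \<open>monom\<close> and \<open>irreducible\<close> are qualified below.
\<close>

definition poly_iter :: "'a :: comm_semiring_1 poly \<Rightarrow> nat \<Rightarrow> 'a poly" where
  "poly_iter g n = (pcompose g ^^ n) [:0, 1:]"

definition P_iter :: "'a :: comm_semiring_1 poly \<Rightarrow> 'a poly \<Rightarrow> nat \<Rightarrow> 'a poly" where
  "P_iter f g n = pcompose f (poly_iter g n)"

definition irred_factor_degrees :: "'a :: field poly \<Rightarrow> nat set" where
  "irred_factor_degrees h = {Polynomial.degree r | r. Factorial_Ring.irreducible r \<and> r dvd h}"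

text \<open>
  \<^const>\<open>Max\<close> and \<^const>\<open>Min\<close> are meaningful here because the set of degrees is finite and
  nonempty as soon as the polynomial is nonconstant, which is the case for
  \<^term>\<open>P_iter f g n\<close> whenever \<open>f\<close> and \<open>g\<close> are nonconstant.
\<close>

definition M_deg :: "'a :: field poly \<Rightarrow> 'a poly \<Rightarrow> nat \<Rightarrow> nat" where
  "M_deg f g n = Max (irred_factor_degrees (P_iter f g n))"

definition m_deg :: "'a :: field poly \<Rightarrow> 'a poly \<Rightarrow> nat \<Rightarrow> nat" where
  "m_deg f g n = Min (irred_factor_degrees (P_iter f g n))"

text \<open>
  \<open>p\<close>-criticality is attributed to the pair \<open>(f, g)\<close>, but \<open>f\<close> plays no role in it; the prime \<open>p\<close>
  is the characteristic of the field.
\<close>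

definition p_critical :: "'a :: field poly \<Rightarrow> 'a poly \<Rightarrow> bool" where
  "p_critical f g \<longleftrightarrow>
     (\<exists>(h :: nat) a b. g = Polynomial.monom a (CHAR('a) ^ h) + [:b:])"

definition critical :: "'a :: field poly \<Rightarrow> 'a poly \<Rightarrow> bool" where
  "critical f g \<longleftrightarrow>
     (\<exists>\<alpha> \<beta> \<gamma>. f = Polynomial.smult \<beta> ([:- \<alpha>, 1:] ^ Polynomial.degree f) \<and>
               g = Polynomial.smult \<gamma> ([:- \<alpha>, 1:] ^ Polynomial.degree g) + [:\<alpha>:])"

definition has_periodic_root :: "'a :: field poly \<Rightarrow> 'a poly \<Rightarrow> bool" where
  "has_periodic_root f g \<longleftrightarrow>
     (\<exists>\<beta> :: 'a alg_closure. poly (map_poly to_ac f) \<beta> = 0 \<and>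
        (\<exists>i\<ge>1. poly (map_poly to_ac (poly_iter g i)) \<beta> = \<beta>))"

end

theory Submission
  imports Defs
begin

text \<open>
  Work in the algebraic closure of the finite field, where \<open>g\<close> becomes a self-map. The roots of
  \<^term>\<open>P_iter f g n\<close> are the points that \<open>n\<close> applications of \<open>g\<close> take to a root of \<open>f\<close>, and the
  degrees of its irreducible factors are the degrees over the base field of these points
  (\<open>irred_factor_degrees_eq\<close>). So both halves of the theorem are about backward orbits of the
  roots of \<open>f\<close>, and both use that only finitely many points have a given degree.

  For the largest degree, the backward orbit grows exponentially. Write \<open>g\<close> as
  \<open>h(x^q)\<close> with \<open>q\<close> a power of the characteristic \<open>p\<close> and \<open>h' \<noteq> 0\<close>; since \<open>g\<close> is not
  \<open>p\<close>-critical, \<open>h\<close> has degree \<open>e \<ge> 2\<close>. Taking \<open>q\<close>-th powers is onto, so \<open>g\<close> has at least as many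
  preimages as \<open>h\<close>. The coincidences among the preimages of \<open>m\<close> points under \<open>h\<close> are zeros of
  \<open>h'\<close>, so at most \<open>e - 1\<close> of the \<open>e m\<close> preimages are lost, for all \<open>m\<close> points together
  (\<open>card_vimage_ge_separable\<close>). From \<open>e m - (e - 1) = e (m - 1) + 1\<close> it follows that the number of
  roots minus one at least doubles at each step, once it is positive. If it stayed zero, then
  the roots of \<open>f\<close> would be a single point \<open>a\<close> whose only preimage is \<open>a\<close>; such a point lies
  in the base field because finite fields are perfect (\<open>unique_root_rational\<close>), and the pair
  would be critical. On the other hand, at most exponentially many points have degree at
  most \<open>M\<close>, so exponentially many roots force \<open>M\<close> to grow linearly.

  For the smallest degree, the point is that \<open>g\<close> does not raise degrees
  (\<open>alg_degree_poly_le\<close>). Hence the smallest degree is monotone in \<open>n\<close>, and for it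
  boundedness is the same as being eventually constant. If it is bounded, then some long orbit
  that ends in a root of \<open>f\<close> stays inside a finite set of points of bounded degree, so it runs
  into a cycle and its end point is periodic. Conversely, a periodic root has for each \<open>n\<close> an \<open>n\<close>-fold preimage
  on its own cycle, which is an iterated image of it and has therefore no larger degree.
\<close>

section \<open>Counting preimages under a separable polynomial\<close>

text \<open>
  In every characteristic, a root of \<open>P\<close> of multiplicity \<open>m\<close> is a root of \<open>P'\<close> of
  multiplicity at least \<open>m - 1\<close>. The set \<open>A\<close> may be larger than the set of roots, so that it
  can stay fixed when linear factors of \<open>P\<close> are removed one by one.
\<close>
lemma dvd_radical_times_pderiv:
  fixes P :: "'k :: alg_closed_field poly"
  assumes "P \<noteq> 0" and "finite A" and "{x. poly P x = 0} \<subseteq> A"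
  shows "P dvd (\<Prod>x\<in>A. [:- x, 1:]) * pderiv P"
  using assms
proof (induction "Polynomial.degree P" arbitrary: P rule: less_induct)
  case (less P)
  show ?case
  proof (cases "Polynomial.degree P = 0")
    case True
    hence "P dvd 1"
      using less.prems by (simp add: is_unit_iff_degree)
    thus ?thesis by (rule unit_imp_dvd)
  next
    case False
    then obtain x where x: "poly P x = 0"
      using alg_closed_imp_poly_has_root by blast
    then obtain Q where P: "P = [:- x, 1:] * Q"
      by (auto simp: poly_eq_0_iff_dvd elim: dvdE)
    have "Q \<noteq> 0" using less.prems P by auto
    hence deg: "Polynomial.degree P = Suc (Polynomial.degree Q)"
      unfolding P by (subst degree_mult_eq) auto
    define R where "R = (\<Prod>y\<in>A. [:- y, 1:])"
    have R: "R = [:- x, 1:] * (\<Prod>y\<in>A - {x}. [:- y, 1:])"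
      unfolding R_def using less.prems x by (intro prod.remove) auto
    have "Q dvd R * pderiv Q"
      unfolding R_def using less.prems \<open>Q \<noteq> 0\<close> deg
      by (intro less.hyps) (auto simp: P)
    hence "P dvd [:- x, 1:] * (R * pderiv Q)"
      unfolding P by (rule mult_dvd_mono[OF dvd_refl])
    moreover have "R * Q = P * (\<Prod>y\<in>A - {x}. [:- y, 1:])"
      unfolding P R by (simp only: mult_ac)
    hence "P dvd R * Q" by simp
    moreover have "pderiv P = Q + [:- x, 1:] * pderiv Q"
      unfolding P by (subst pderiv_mult) (simp add: pderiv_pCons)
    hence "R * pderiv P = R * Q + [:- x, 1:] * (R * pderiv Q)"
      by (simp only: distrib_left mult_ac)
    ultimately show ?thesis
      unfolding R_def[symmetric] by (metis dvd_add)
  qed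
qed

lemma finite_vimage_poly:
  fixes P :: "'k :: idom poly"
  assumes "Polynomial.degree P \<ge> 1" and "finite S"
  shows "finite (poly P -` S)"
proof -
  have "P - [:c:] \<noteq> 0" for c
    using assms(1) by (metis degree_pCons_0 eq_iff_diff_eq_0 not_one_le_zero)
  moreover have "poly P -` S = (\<Union>c\<in>S. {x. poly (P - [:c:]) x = 0})" by auto
  ultimately show ?thesis
    using assms(2) by (auto intro!: poly_roots_finite simp del: poly_diff)
qed

text \<open>
  The polynomials \<open>H - c\<close> for \<open>c\<close> in \<open>S\<close> are pairwise coprime but share the
  derivative \<open>H'\<close>. So their product divides the radical of the product times a single factor
  \<open>H'\<close>, and the bound is a comparison of degrees. What matters is that \<open>degree H - 1\<close> is paid
  once and not once for every point of \<open>S\<close>.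
\<close>
lemma card_vimage_ge_separable:
  fixes H :: "'k :: {alg_closed_field, factorial_ring_gcd, semiring_gcd_mult_normalize} poly"
  assumes "pderiv H \<noteq> 0" and "finite S"
  shows "Polynomial.degree H * card S \<le> card (poly H -` S) + (Polynomial.degree H - 1)"
proof -
  have deg: "Polynomial.degree H \<ge> 1"
    using assms(1) by (metis One_nat_def Suc_leI degree_eq_zeroE gr0I pderiv_singleton)
  have nz: "H - [:c:] \<noteq> 0" for c
    using deg by (metis degree_pCons_0 eq_iff_diff_eq_0 not_one_le_zero)
  have fin: "finite (poly H -` S)" using deg assms(2) by (rule finite_vimage_poly)
  define R where "R = (\<Prod>x\<in>poly H -` S. [:- x, 1:])"
  have dvd: "H - [:c:] dvd R * pderiv H" if "c \<in> S" for c
    using dvd_radical_times_pderiv[OF nz fin, of c] that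
    by (auto simp: R_def pderiv_diff)
  have coprime: "coprime (H - [:c:]) (H - [:d:])" if "c \<noteq> d" for c d
  proof (rule coprimeI)
    fix r assume "r dvd H - [:c:]" "r dvd H - [:d:]"
    hence "r dvd (H - [:d:]) - (H - [:c:])" by (rule dvd_diff[rotated])
    also have "(H - [:d:]) - (H - [:c:]) = [:c - d:]" by simp
    also have "[:c - d:] dvd 1"
      using that by (simp add: is_unit_pCons_iff dvd_field_iff)
    finally show "r dvd 1" .
  qed
  have "(\<Prod>c\<in>S. H - [:c:]) dvd R * pderiv H"
    using \<open>finite S\<close> dvd
  proof (induction S rule: finite_induct)
    case (insert c S)
    have "coprime (H - [:c:]) (\<Prod>d\<in>S. H - [:d:])"
      using insert.hyps by (intro prod_coprime_right coprime) auto
    with insert show ?case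
      by (simp add: divides_mult)
  qed simp
  moreover have R0: "R \<noteq> 0"
    unfolding R_def using fin by simp
  ultimately have "Polynomial.degree (\<Prod>c\<in>S. H - [:c:]) \<le> Polynomial.degree (R * pderiv H)"
    using assms(1) by (intro dvd_imp_degree_le) auto
  also have "Polynomial.degree (\<Prod>c\<in>S. H - [:c:]) = (\<Sum>c\<in>S. Polynomial.degree (H - [:c:]))"
    using nz by (intro degree_prod_eq_sum_degree) auto
  also have "\<dots> = Polynomial.degree H * card S"
  proof -
    have "Polynomial.degree (H - [:c:]) = Polynomial.degree H" for c
      using degree_add_eq_left[of "- [:c:]" H] deg by (simp del: minus_pCons)
    thus ?thesis by simp
  qed
  also have "Polynomial.degree (R * pderiv H) = Polynomial.degree R + Polynomial.degree (pderiv H)"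
    using R0 assms(1) by (rule degree_mult_eq)
  also have "Polynomial.degree R = card (poly H -` S)"
    unfolding R_def by (subst degree_prod_eq_sum_degree) auto
  also have "Polynomial.degree (pderiv H) \<le> Polynomial.degree H - 1"
    by (rule degree_le) (auto simp: coeff_pderiv coeff_eq_0)
  finally show "Polynomial.degree H * card S
                  \<le> card (poly H -` S) + (Polynomial.degree H - 1)"
    by simp
qed

section \<open>Splitting off the inseparable part\<close>

lemma pcompose_monom:
  fixes g :: "'a :: field poly"
  shows "pcompose (Polynomial.monom c i) g = Polynomial.smult c (g ^ i)"
  by (induction i) (auto simp: monom_Suc monom_0 pcompose_pCons)

lemma pderiv_eq_0_imp_pcompose_monom_CHAR:
  fixes g :: "'a :: finite_field poly"
  assumes "pderiv g = 0"
  obtains h where "g = pcompose h (Polynomial.monom 1 CHAR('a))"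
proof -
  define p where "p = CHAR('a)"
  have p: "p > 0" by (simp add: p_def)
  define h where "h = (\<Sum>i\<le>Polynomial.degree g. Polynomial.monom (Polynomial.coeff g (p * i)) i)"
  have *: "Polynomial.coeff g n = 0" if "\<not> p dvd n" for n
  proof (cases n)
    case (Suc m)
    have "of_nat (Suc m) * Polynomial.coeff g (Suc m) = 0"
      using assms by (metis coeff_0 coeff_pderiv)
    with that Suc show ?thesis
      unfolding p_def by (metis mult_eq_0_iff of_nat_eq_0_iff_char_dvd)
  qed (use that in auto)
  have "pcompose h (Polynomial.monom 1 p) =
        (\<Sum>i\<le>Polynomial.degree g. Polynomial.monom (Polynomial.coeff g (p * i)) (p * i))"
    unfolding h_def by (simp add: pcompose_sum pcompose_monom monom_power smult_monom)
  also have "\<dots> = g"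
  proof (rule poly_eqI)
    fix n
    have "Polynomial.coeff (\<Sum>i\<le>Polynomial.degree g. Polynomial.monom (Polynomial.coeff g (p * i)) (p * i)) n
        = (\<Sum>i\<le>Polynomial.degree g. if p * i = n then Polynomial.coeff g n else 0)"
      by (auto simp: Polynomial.coeff_sum intro!: sum.cong)
    also have "\<dots> = Polynomial.coeff g n"
    proof (cases "p dvd n \<and> n \<le> Polynomial.degree g")
      case True
      then obtain j where j: "n = p * j" by auto
      have "j \<le> Polynomial.degree g"
        using True j p by (metis One_nat_def Suc_leI le_trans mult_le_mono1 nat_mult_1)
      moreover have "p * i = n \<longleftrightarrow> i = j" for i using j p by simp
      ultimately show ?thesis by simp
    next
      case False
      hence "Polynomial.coeff g n = 0"
        using * by (auto simp: coeff_eq_0)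
      thus ?thesis by (simp add: sum.neutral)
    qed
    finally show "Polynomial.coeff (\<Sum>i\<le>Polynomial.degree g. Polynomial.monom (Polynomial.coeff g (p * i)) (p * i)) n
      = Polynomial.coeff g n" .
  qed
  finally show ?thesis using that unfolding p_def by metis
qed

text \<open>
  As long as the derivative vanishes, a substitution \<open>x \<mapsto> x^p\<close> can be split off, which
  lowers the degree.
\<close>
lemma separable_decomposition:
  fixes g :: "'a :: finite_field poly"
  assumes "Polynomial.degree g \<ge> 1"
  obtains h s where "g = pcompose h (Polynomial.monom 1 (CHAR('a) ^ s))" and "pderiv h \<noteq> 0"
  using assms
proof (induction "Polynomial.degree g" arbitrary: g thesis rule: less_induct)
  case (less g)
  show ?case
  proof (cases "pderiv g = 0")
    case False
    show ?thesis
      by (rule less.prems(1)[of g 0]) (use False in \<open>simp_all add: monom_Suc monom_0\<close>)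
  next
    case True
    then obtain u where u: "g = pcompose u (Polynomial.monom 1 CHAR('a))"
      by (rule pderiv_eq_0_imp_pcompose_monom_CHAR)
    have "prime CHAR('a)" by (rule prime_CHAR_semidom) simp
    hence p: "CHAR('a) > 1" by (rule prime_gt_1_nat)
    have deg: "Polynomial.degree g = Polynomial.degree u * CHAR('a)"
      by (simp add: u degree_pcompose degree_monom_eq)
    hence "Polynomial.degree u \<ge> 1" using less.prems(2) by (cases "Polynomial.degree u") auto
    moreover from this have "Polynomial.degree u < Polynomial.degree g" using p deg by simp
    ultimately obtain h s where h: "u = pcompose h (Polynomial.monom 1 (CHAR('a) ^ s))" "pderiv h \<noteq> 0"
      using less.hyps by blast
    have "g = pcompose h (pcompose (Polynomial.monom 1 (CHAR('a) ^ s)) (Polynomial.monom 1 CHAR('a)))"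
      by (simp add: u h pcompose_assoc)
    also have "pcompose (Polynomial.monom 1 (CHAR('a) ^ s)) (Polynomial.monom 1 CHAR('a)) =
        (Polynomial.monom 1 (CHAR('a) ^ Suc s) :: 'a poly)"
      by (simp add: pcompose_monom monom_power)
    finally show ?thesis using h(2) by (rule less.prems(1))
  qed
qed

section \<open>Polynomials over the field as polynomials over its closure\<close>

abbreviation ac_poly :: "'a :: field poly \<Rightarrow> 'a alg_closure poly" where
  "ac_poly \<equiv> map_poly to_ac"

abbreviation ac_roots :: "'a :: field poly \<Rightarrow> 'a alg_closure set" where
  "ac_roots p \<equiv> {x. poly (ac_poly p) x = 0}"

lemma degree_ac_poly [simp]: "Polynomial.degree (ac_poly p) = Polynomial.degree p"
  by (rule degree_map_poly) simp

lemma ac_poly_eq_0_iff [simp]: "ac_poly p = 0 \<longleftrightarrow> p = 0"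
  by (rule map_poly_eq_0_iff) auto

lemma ac_poly_add [simp]: "ac_poly (p + q) = ac_poly p + ac_poly q"
  by (rule poly_eqI) (simp add: coeff_map_poly)

lemma ac_poly_diff [simp]: "ac_poly (p - q) = ac_poly p - ac_poly q"
  by (rule poly_eqI) (simp add: coeff_map_poly)

lemma ac_poly_mult [simp]: "ac_poly (p * q) = ac_poly p * ac_poly q"
  by (rule poly_eqI) (simp add: coeff_map_poly Polynomial.coeff_mult to_ac_sum)

lemma ac_poly_power [simp]: "ac_poly (p ^ n) = ac_poly p ^ n"
  by (induction n) auto

lemma ac_poly_pCons [simp]: "ac_poly (pCons a p) = pCons (to_ac a) (ac_poly p)"
  by (rule map_poly_pCons) simp

lemma ac_poly_smult [simp]: "ac_poly (Polynomial.smult c p) = Polynomial.smult (to_ac c) (ac_poly p)"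
  by (rule map_poly_smult) auto

lemma ac_poly_monom [simp]: "ac_poly (Polynomial.monom c n) = Polynomial.monom (to_ac c) n"
  by (rule map_poly_monom) simp

lemma ac_poly_pcompose [simp]: "ac_poly (pcompose p q) = pcompose (ac_poly p) (ac_poly q)"
  by (induction p) (auto simp: pcompose_pCons)

lemma ac_poly_pderiv [simp]: "ac_poly (pderiv p) = pderiv (ac_poly p)"
  by (rule poly_eqI) (simp add: coeff_map_poly coeff_pderiv)

lemma ac_poly_eq_iff: "ac_poly p = ac_poly q \<longleftrightarrow> p = q"
  using ac_poly_eq_0_iff[of "p - q"] by (simp del: ac_poly_eq_0_iff)

lemma finite_ac_roots: "p \<noteq> 0 \<Longrightarrow> finite (ac_roots p)"
  by (rule poly_roots_finite) simp

lemma ac_roots_nonempty: "Polynomial.degree p \<ge> 1 \<Longrightarrow> ac_roots p \<noteq> {}"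
  using alg_closed_imp_poly_has_root[of "ac_poly p"] by auto

text \<open>
  The separable part \<open>h\<close> of \<open>g\<close> has degree \<open>e \<ge> 2\<close>, since \<open>e = 1\<close> is precisely
  \<open>p\<close>-criticality, and \<open>e\<close> may be replaced by \<open>2\<close> in the bound
  \<open>e (card S - 1) + 1\<close> because \<open>S\<close> is nonempty. The inseparable part does not reduce the
  number of preimages because every element of the closure has a \<open>q\<close>-th root.
\<close>
lemma card_vimage_ge:
  fixes g :: "'a :: finite_field poly"
  assumes "Polynomial.degree g \<ge> 2" and "\<not> p_critical f g" and "finite S" and "S \<noteq> {}"
  shows "2 * card S \<le> card (poly (ac_poly g) -` S) + 1"
proof -
  obtain h s where g: "g = pcompose h (Polynomial.monom 1 (CHAR('a) ^ s))" and h: "pderiv h \<noteq> 0"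
    using separable_decomposition[of g] assms(1) by auto
  define e where "e = Polynomial.degree h"
  have "e \<noteq> 0"
    using h unfolding e_def by (metis degree_eq_zeroE pderiv_singleton)
  moreover have "e \<noteq> 1"
  proof
    assume "e = 1"
    then obtain a b where "h = [:b, a:]"
      unfolding e_def by (metis One_nat_def degree_eq_zeroE degree_pCons_eq_if nat.inject pCons_cases zero_neq_one)
    hence "g = Polynomial.monom a (CHAR('a) ^ s) + [:b:]"
      unfolding g by (simp add: pcompose_pCons mult.commute smult_monom)
    with assms(2) show False unfolding p_critical_def by blast
  qed
  ultimately have e: "e \<ge> 2" by linarith
  define H where "H = ac_poly h"
  have H: "pderiv H \<noteq> 0"
    unfolding H_def using h by (metis ac_poly_eq_0_iff ac_poly_pderiv)
  define q where "q = CHAR('a) ^ s"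
  have q: "q > 0" unfolding q_def by simp
  have G: "poly (ac_poly g) x = poly H (x ^ q)" for x
    unfolding g H_def q_def by (simp add: poly_pcompose poly_monom)
  have fin: "finite (poly (ac_poly g) -` S)"
    using assms(1,3) by (intro finite_vimage_poly) auto
  have "poly H -` S \<subseteq> (\<lambda>x. x ^ q) ` (poly (ac_poly g) -` S)"
  proof
    fix y assume y: "y \<in> poly H -` S"
    obtain x where "x ^ q = y" using nth_root_exists[OF q] by blast
    with y G show "y \<in> (\<lambda>x. x ^ q) ` (poly (ac_poly g) -` S)" by force
  qed
  with fin have "card (poly H -` S) \<le> card (poly (ac_poly g) -` S)"
    by (meson card_image_le card_mono finite_imageI order_trans)
  moreover have "e * card S \<le> card (poly H -` S) + (e - 1)"
    using card_vimage_ge_separable[OF H assms(3)] by (simp add: e_def H_def)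
  ultimately have main: "e * card S \<le> card (poly (ac_poly g) -` S) + (e - 1)" by linarith
  obtain e' where e': "e = e' + 2" using e by (metis add.commute le_Suc_ex)
  obtain c where c: "card S = c + 1"
    using assms(3,4) by (metis Suc_eq_plus1 card_gt_0_iff gr0_implies_Suc)
  show ?thesis using main unfolding e' c by (simp add: algebra_simps)
qed

section \<open>A unique root is rational\<close>

lemma unique_root_imp_linear_power:
  fixes P :: "'k :: alg_closed_field poly"
  assumes "P \<noteq> 0" and "{x. poly P x = 0} \<subseteq> {a}"
  shows "P = Polynomial.smult (lead_coeff P) ([:- a, 1:] ^ Polynomial.degree P)"
proof -
  obtain A where A: "size A = Polynomial.degree P"
      "P = Polynomial.smult (lead_coeff P) (\<Prod>x\<in>#A. [:- x, 1:])"
    using alg_closed_imp_factorization[OF assms(1)] by blast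
  have "x = a" if "x \<in># A" for x
  proof -
    have "poly P x = 0"
      using that by (subst A(2)) (auto simp: poly_prod_mset prod_mset_zero_iff)
    thus ?thesis using assms(2) by auto
  qed
  hence "A = replicate_mset (Polynomial.degree P) a"
    using A(1) by (metis set_mset_subset_singletonD subsetI singletonI)
  with A(2) show ?thesis by simp
qed

lemma rational_unique_root_imp_linear_power:
  fixes f :: "'a :: field poly"
  assumes "f \<noteq> 0" and "ac_roots f \<subseteq> {to_ac \<alpha>}"
  shows "f = Polynomial.smult (lead_coeff f) ([:- \<alpha>, 1:] ^ Polynomial.degree f)"
proof -
  have "ac_poly f = Polynomial.smult (lead_coeff (ac_poly f)) ([:- to_ac \<alpha>, 1:] ^ Polynomial.degree (ac_poly f))"
    using assms by (intro unique_root_imp_linear_power) auto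
  also have "\<dots> = ac_poly (Polynomial.smult (lead_coeff f) ([:- \<alpha>, 1:] ^ Polynomial.degree f))"
    by (simp add: coeff_map_poly)
  finally show ?thesis by (simp only: ac_poly_eq_iff)
qed

lemma CHAR_power_eq_imp_eq:
  fixes x y :: "'k :: field_prime_char"
  assumes "x ^ CHAR('k) = y ^ CHAR('k)"
  shows "x = y"
proof -
  have pr: "prime CHAR('k)" by (rule prime_CHAR_semidom) simp
  have "x ^ CHAR('k) = (x - y) ^ CHAR('k) + y ^ CHAR('k)"
    using freshmans_dream[OF pr refl, of "x - y" y] by simp
  with assms have "(x - y) ^ CHAR('k) = 0" by simp
  thus ?thesis by simp
qed

text \<open>
  If \<open>f' = 0\<close>, then \<open>f = h(x^p)\<close> and \<open>a^p\<close> is the only root of \<open>h\<close>; it is rational by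
  induction, and so is its unique \<open>p\<close>-th root \<open>a\<close>, as the Frobenius map is bijective on
  the base field. If \<open>f' \<noteq> 0\<close> and \<open>f\<close> is not linear, then \<open>f = c (x - a)^k\<close> with
  \<open>k \<ge> 2\<close>, and \<open>f'\<close> is a polynomial over the base field of smaller degree with the same
  only root.
\<close>
lemma unique_root_rational:
  fixes f :: "'a :: finite_field poly"
  assumes "Polynomial.degree f \<ge> 1" and "ac_roots f \<subseteq> {a}"
  shows "a \<in> range to_ac"
  using assms
proof (induction "Polynomial.degree f" arbitrary: f a rule: less_induct)
  case (less f)
  let ?p = "CHAR('a)"
  have pr: "prime ?p" by (rule prime_CHAR_semidom) simp
  hence p: "?p > 1" by (rule prime_gt_1_nat)
  show ?case
  proof (cases "pderiv f = 0")
    case True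
    then obtain h where h: "f = pcompose h (Polynomial.monom 1 ?p)"
      by (rule pderiv_eq_0_imp_pcompose_monom_CHAR)
    have deg: "Polynomial.degree f = Polynomial.degree h * ?p"
      by (simp add: h degree_pcompose degree_monom_eq)
    hence h1: "Polynomial.degree h \<ge> 1" using less.prems(1) by (cases "Polynomial.degree h") auto
    hence "Polynomial.degree h < Polynomial.degree f" using p deg by simp
    moreover have "ac_roots h \<subseteq> {a ^ ?p}"
    proof
      fix y assume y: "y \<in> ac_roots h"
      obtain x where x: "x ^ ?p = y" using nth_root_exists[of ?p y] p by auto
      have "x \<in> ac_roots f" using x y by (simp add: h poly_pcompose poly_monom)
      with less.prems(2) x show "y \<in> {a ^ ?p}" by auto
    qed
    ultimately obtain b where b: "a ^ ?p = to_ac b"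
      using less.hyps h1 by blast
    have "inj (\<lambda>c :: 'a. c ^ ?p)" by (rule injI) (rule CHAR_power_eq_imp_eq)
    hence "surj (\<lambda>c :: 'a. c ^ ?p)" by (rule finite_UNIV_inj_surj[OF finite])
    then obtain c where c: "b = c ^ ?p" by (rule surjE)
    have "(a - to_ac c) ^ ?p + to_ac c ^ ?p = a ^ ?p"
    proof -
      have "prime CHAR('a alg_closure)" using pr by simp
      from freshmans_dream[OF this CHAR_alg_closure[symmetric], of "a - to_ac c" "to_ac c"]
      show ?thesis by (simp only: diff_add_cancel)
    qed
    hence "(a - to_ac c) ^ ?p = 0" using b c by simp
    thus ?thesis by auto
  next
    case False
    show ?thesis
    proof (cases "Polynomial.degree f = 1")
      case True
      then obtain b c where f: "f = [:b, c:]" "c \<noteq> 0"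
        by (metis One_nat_def degree_eq_zeroE degree_pCons_eq_if nat.inject pCons_cases zero_neq_one pCons_0_0)
      have "to_ac (- b / c) \<in> ac_roots f" using f(2) by (simp add: f(1))
      with less.prems(2) have "a = to_ac (- b / c)" by blast
      thus ?thesis by (rule range_eqI)
    next
      case neq: False
      define k where "k = Polynomial.degree f"
      have "ac_poly f = Polynomial.smult (lead_coeff (ac_poly f)) ([:- a, 1:] ^ Polynomial.degree (ac_poly f))"
        using less.prems by (intro unique_root_imp_linear_power) auto
      hence F: "ac_poly f = Polynomial.smult (to_ac (lead_coeff f)) ([:- a, 1:] ^ Suc (k - 1))"
        using less.prems(1) by (simp add: coeff_map_poly k_def del: power_Suc)
      define C where "C = to_ac (lead_coeff f) * of_nat (Suc (k - 1))"
      have F': "ac_poly (pderiv f) = Polynomial.smult C ([:- a, 1:] ^ (k - 1))"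
        unfolding ac_poly_pderiv F pderiv_smult pderiv_power_Suc C_def
        by (simp add: pderiv_pCons)
      have "C \<noteq> 0" using F' False by (metis ac_poly_eq_0_iff smult_0_left)
      have "Polynomial.degree (ac_poly (pderiv f)) = k - 1"
        unfolding F' using \<open>C \<noteq> 0\<close> by (simp add: degree_linear_power)
      hence d: "Polynomial.degree (pderiv f) = k - 1" by (simp del: ac_poly_pderiv)
      have "ac_roots (pderiv f) \<subseteq> {a}"
        unfolding F' using \<open>C \<noteq> 0\<close> by auto
      moreover have "k \<ge> 2" using neq less.prems(1) by (simp add: k_def)
      ultimately show ?thesis
        using less.hyps[of "pderiv f" a] d by (simp add: k_def)
    qed
  qed
qed


text \<open>
  Both \<open>f\<close> and \<open>g - a\<close> have \<open>a\<close> as their only root, hence are powers of \<open>x - a\<close> up to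
  constants.
\<close>
lemma unique_fixed_preimage_imp_critical:
  fixes f g :: "'a :: finite_field poly"
  assumes "Polynomial.degree f \<ge> 1" and "Polynomial.degree g \<ge> 1"
    and "ac_roots f = {a}" and "poly (ac_poly g) -` {a} = {a}"
  shows "critical f g"
proof -
  obtain \<alpha> where \<alpha>: "a = to_ac \<alpha>"
    using unique_root_rational[of f a] assms by auto
  have deg: "Polynomial.degree (g - [:\<alpha>:]) = Polynomial.degree g"
    using degree_add_eq_left[of "- [:\<alpha>:]" g] assms(2) by (simp del: minus_pCons)
  have "f = Polynomial.smult (lead_coeff f) ([:- \<alpha>, 1:] ^ Polynomial.degree f)"
    using assms \<alpha> by (intro rational_unique_root_imp_linear_power) auto
  moreover have "g - [:\<alpha>:] =
      Polynomial.smult (lead_coeff (g - [:\<alpha>:])) ([:- \<alpha>, 1:] ^ Polynomial.degree (g - [:\<alpha>:]))"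
  proof (rule rational_unique_root_imp_linear_power)
    show "g - [:\<alpha>:] \<noteq> 0" using deg assms(2) by auto
    show "ac_roots (g - [:\<alpha>:]) \<subseteq> {to_ac \<alpha>}"
      using assms(4) \<alpha> by auto
  qed
  hence "g = Polynomial.smult (lead_coeff (g - [:\<alpha>:])) ([:- \<alpha>, 1:] ^ Polynomial.degree g) + [:\<alpha>:]"
    unfolding deg by (metis diff_add_cancel)
  ultimately show ?thesis unfolding critical_def by blast
qed

section \<open>Degrees of algebraic elements\<close>

text \<open>
  The degree of the field extension generated by \<open>x\<close>, as the degree of its minimal polynomial.
\<close>
definition alg_degree :: "'a :: field alg_closure \<Rightarrow> nat" where
  "alg_degree x = (LEAST d. \<exists>s :: 'a poly. s \<noteq> 0 \<and> x \<in> ac_roots s \<and> Polynomial.degree s = d)"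

lemma alg_degree_le:
  "s \<noteq> 0 \<Longrightarrow> x \<in> ac_roots s \<Longrightarrow> alg_degree x \<le> Polynomial.degree s"
  unfolding alg_degree_def by (rule Least_le) blast

lemma obtain_min_poly:
  fixes x :: "'a :: field alg_closure"
  obtains s :: "'a poly" where "s \<noteq> 0" "x \<in> ac_roots s" "Polynomial.degree s = alg_degree x"
proof -
  have "\<exists>d. \<exists>s :: 'a poly. s \<noteq> 0 \<and> x \<in> ac_roots s \<and> Polynomial.degree s = d"
    using alg_closure_algebraic[of x] by blast
  from LeastI_ex[OF this] show ?thesis
    using that unfolding alg_degree_def by blast
qed

lemma alg_degree_pos: "alg_degree x > 0"
proof -
  obtain s :: "'a poly" where s: "s \<noteq> 0" "x \<in> ac_roots s" "Polynomial.degree s = alg_degree x"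
    by (rule obtain_min_poly)
  show ?thesis
  proof (rule ccontr)
    assume "\<not> ?thesis"
    then obtain c where "s = [:c:]" using s(3) by (auto elim: degree_eq_zeroE)
    with s show False by simp
  qed
qed

lemma min_poly_dvd:
  fixes s p :: "'a :: field poly"
  assumes "s \<noteq> 0" "x \<in> ac_roots s" "Polynomial.degree s = alg_degree x" "x \<in> ac_roots p"
  shows "s dvd p"
proof (rule ccontr)
  assume "\<not> s dvd p"
  hence r: "p mod s \<noteq> 0" by (simp add: mod_eq_0_iff_dvd)
  have "ac_poly p = ac_poly (p div s * s + p mod s)" by simp
  hence "x \<in> ac_roots (p mod s)"
    using assms(2,4) by (simp only: ac_poly_add ac_poly_mult) simp
  hence "alg_degree x \<le> Polynomial.degree (p mod s)" using r by (intro alg_degree_le)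
  moreover have "Polynomial.degree (p mod s) < Polynomial.degree s"
    using assms(1) r by (rule degree_mod_less')
  ultimately show False using assms(3) by simp
qed

lemma min_poly_irreducible:
  fixes s :: "'a :: field poly"
  assumes "s \<noteq> 0" "x \<in> ac_roots s" "Polynomial.degree s = alg_degree x"
  shows "Factorial_Ring.irreducible s"
proof (rule Factorial_Ring.irreducibleI)
  show "\<not> s dvd 1"
    using assms alg_degree_pos[of x] by (simp add: is_unit_iff_degree)
  fix u v assume uv: "s = u * v"
  have nz: "u \<noteq> 0" "v \<noteq> 0" using assms(1) uv by auto
  have deg: "Polynomial.degree s = Polynomial.degree u + Polynomial.degree v"
    unfolding uv using nz by (rule degree_mult_eq)
  have "x \<in> ac_roots u \<or> x \<in> ac_roots v" using assms(2) by (simp add: uv)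
  hence "Polynomial.degree v = 0 \<or> Polynomial.degree u = 0"
    using alg_degree_le[of u x] alg_degree_le[of v x] nz assms(3) deg by linarith
  thus "u dvd 1 \<or> v dvd 1" using nz by (auto simp: is_unit_iff_degree)
qed fact

text \<open>
  Every irreducible polynomial is, up to a constant, the minimal polynomial of each of its
  roots. This turns statements on factors into statements on points.
\<close>
lemma irred_factor_degrees_eq:
  fixes p :: "'a :: field poly"
  shows "irred_factor_degrees p = alg_degree ` ac_roots p"
proof (intro equalityI subsetI)
  fix d assume "d \<in> irred_factor_degrees p"
  then obtain r where r: "Factorial_Ring.irreducible r" "r dvd p" "d = Polynomial.degree r"
    unfolding irred_factor_degrees_def by blast
  have "r \<noteq> 0" "\<not> r dvd 1" using r(1) by (auto simp: Factorial_Ring.irreducible_def)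
  hence "Polynomial.degree r \<ge> 1" by (simp add: is_unit_iff_degree)
  then obtain x where x: "x \<in> ac_roots r" using ac_roots_nonempty by blast
  obtain s :: "'a poly" where s: "s \<noteq> 0" "x \<in> ac_roots s" "Polynomial.degree s = alg_degree x"
    by (rule obtain_min_poly)
  then obtain t where t: "r = s * t" using min_poly_dvd x by (blast elim: dvdE)
  have "\<not> s dvd 1" using s alg_degree_pos[of x] by (simp add: is_unit_iff_degree)
  hence "t dvd 1" using Factorial_Ring.irreducibleD[OF r(1) t] by blast
  moreover have "t \<noteq> 0" using t \<open>r \<noteq> 0\<close> by auto
  ultimately have "Polynomial.degree t = 0" by (simp add: is_unit_iff_degree)
  hence "d = alg_degree x"
    using r(3) t s \<open>t \<noteq> 0\<close> by (simp add: degree_mult_eq)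
  moreover have "x \<in> ac_roots p" using r(2) x by (auto elim: dvdE)
  ultimately show "d \<in> alg_degree ` ac_roots p" by blast
next
  fix d assume "d \<in> alg_degree ` ac_roots p"
  then obtain x where x: "x \<in> ac_roots p" "d = alg_degree x" by blast
  obtain s :: "'a poly" where s: "s \<noteq> 0" "x \<in> ac_roots s" "Polynomial.degree s = alg_degree x"
    by (rule obtain_min_poly)
  have "Factorial_Ring.irreducible s" "s dvd p"
    using min_poly_irreducible[OF s] min_poly_dvd[OF s x(1)] by blast+
  thus "d \<in> irred_factor_degrees p" unfolding irred_factor_degrees_def using s(3) x(2) by force
qed

lemma polys_of_bounded_degree:
  fixes d :: nat
  defines "A \<equiv> {p :: 'a :: {finite, zero} poly. Polynomial.degree p \<le> d}"
  shows "finite A" and "card A \<le> card (UNIV :: 'a set) ^ Suc d"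
proof -
  let ?L = "{xs :: 'a list. set xs \<subseteq> UNIV \<and> length xs = Suc d}"
  have "A \<subseteq> Poly ` ?L"
  proof
    fix p assume "p \<in> A"
    hence "p = Poly (map (Polynomial.coeff p) [0..<Suc d])"
      by (intro poly_eqI) (auto simp: A_def nth_default_def coeff_eq_0 simp del: upt_Suc)
    thus "p \<in> Poly ` ?L" by (rule image_eqI) auto
  qed
  moreover have fin: "finite ?L" by (rule finite_lists_length_eq) simp
  ultimately show "finite A" by (meson finite_imageI finite_subset)
  have "card A \<le> card ?L"
    using \<open>A \<subseteq> Poly ` ?L\<close> fin by (meson card_image_le card_mono finite_imageI order_trans)
  also have "card ?L = card (UNIV :: 'a set) ^ Suc d" by (rule card_lists_length_eq) simp
  finally show "card A \<le> card (UNIV :: 'a set) ^ Suc d" .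
qed

lemma elements_of_bounded_degree:
  fixes d :: nat
  defines "A \<equiv> {x :: 'a :: finite_field alg_closure. alg_degree x \<le> d}"
  shows "finite A" and "card A \<le> card (UNIV :: 'a set) ^ Suc d * d"
proof -
  let ?B = "{p :: 'a poly. Polynomial.degree p \<le> d} - {0}"
  have fin: "finite ?B" by (rule finite_Diff, rule polys_of_bounded_degree)
  have A: "A \<subseteq> (\<Union>p\<in>?B. ac_roots p)"
  proof
    fix x assume "x \<in> A"
    moreover obtain s :: "'a poly" where "s \<noteq> 0" "x \<in> ac_roots s" "Polynomial.degree s = alg_degree x"
      by (rule obtain_min_poly)
    ultimately show "x \<in> (\<Union>p\<in>?B. ac_roots p)" unfolding A_def by (intro UN_I[of s]) auto
  qed
  have finU: "finite (\<Union>p\<in>?B. ac_roots p)" using fin by (auto intro: finite_ac_roots)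
  thus "finite A" using A by (rule finite_subset[rotated])
  have "card A \<le> card (\<Union>p\<in>?B. ac_roots p)" using finU A by (rule card_mono)
  also have "\<dots> \<le> (\<Sum>p\<in>?B. card (ac_roots p))" using fin by (rule card_UN_le)
  also have "\<dots> \<le> (\<Sum>p\<in>?B. d)"
  proof (rule sum_mono)
    fix p assume p: "p \<in> ?B"
    hence "card (ac_roots p) \<le> Polynomial.degree (ac_poly p)"
      by (intro card_poly_roots_bound) simp
    with p show "card (ac_roots p) \<le> d" by simp
  qed
  also have "\<dots> = card ?B * d" by simp
  also have "card ?B \<le> card {p :: 'a poly. Polynomial.degree p \<le> d}"
    by (rule card_mono) (auto intro: polys_of_bounded_degree)
  also have "\<dots> \<le> card (UNIV :: 'a set) ^ Suc d" by (rule polys_of_bounded_degree)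
  finally show "card A \<le> card (UNIV :: 'a set) ^ Suc d * d" by simp
qed

text \<open>
  The field generated by \<open>h(x)\<close> lies in the one generated by \<open>x\<close>. Over a finite field the
  resulting linear relation between the powers of \<open>h(x)\<close> comes from counting: modulo the
  minimal polynomial of \<open>x\<close>, which has degree \<open>d\<close>, there are fewer residues than polynomials
  \<open>t\<close> of degree at most \<open>d\<close>, so two of the compositions \<open>t(h)\<close> have the same residue.
\<close>
lemma alg_degree_poly_le:
  fixes h :: "'a :: finite_field poly"
  shows "alg_degree (poly (ac_poly h) x) \<le> alg_degree x"
proof -
  define d where "d = alg_degree x"
  obtain s :: "'a poly" where s: "s \<noteq> 0" "x \<in> ac_roots s" "Polynomial.degree s = d"
    unfolding d_def by (rule obtain_min_poly)
  have d: "d > 0" unfolding d_def by (rule alg_degree_pos)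
  let ?A = "{t :: 'a poly. Polynomial.degree t \<le> d}" and ?B = "{t :: 'a poly. Polynomial.degree t < d}"
  have "?B \<subset> ?A"
  proof (rule psubsetI)
    show "?B \<noteq> ?A"
    proof
      assume "?B = ?A"
      moreover have "Polynomial.monom 1 d \<in> ?A" by (simp add: degree_monom_eq)
      ultimately have "Polynomial.monom 1 d \<in> ?B" by simp
      thus False by (simp add: degree_monom_eq)
    qed
  qed auto
  hence less: "card ?B < card ?A" by (rule psubset_card_mono[OF polys_of_bounded_degree(1)])
  let ?\<phi> = "\<lambda>t. pcompose t h mod s"
  have sub: "?\<phi> ` ?A \<subseteq> ?B"
  proof (intro image_subsetI CollectI)
    fix t
    show "Polynomial.degree (?\<phi> t) < d"
      using degree_mod_less[OF s(1), of "pcompose t h"] s(3) d by auto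
  qed
  have "finite ?B" by (rule finite_subset[OF _ polys_of_bounded_degree(1)[of d]]) auto
  hence "card (?\<phi> ` ?A) < card ?A" using less card_mono[OF _ sub] by linarith
  hence "\<not> inj_on ?\<phi> ?A" by (rule pigeonhole)
  then obtain t u where tu: "t \<in> ?A" "u \<in> ?A" "t \<noteq> u" "?\<phi> t = ?\<phi> u"
    unfolding inj_on_def by blast
  have "s dvd pcompose t h - pcompose u h" using tu(4) by (simp add: mod_eq_dvd_iff)
  then obtain v where "pcompose (t - u) h = s * v" by (auto simp: pcompose_diff elim: dvdE)
  hence "ac_poly (pcompose (t - u) h) = ac_poly s * ac_poly v" by simp
  hence "poly (pcompose (ac_poly (t - u)) (ac_poly h)) x = 0"
    using s(2) by (simp only: ac_poly_pcompose) simp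
  hence "poly (ac_poly h) x \<in> ac_roots (t - u)" by (simp add: poly_pcompose)
  hence "alg_degree (poly (ac_poly h) x) \<le> Polynomial.degree (t - u)"
    using tu(3) by (intro alg_degree_le) auto
  also have "\<dots> \<le> d" using tu(1,2) by (intro degree_diff_le) auto
  finally show ?thesis unfolding d_def .
qed


section \<open>Roots of the iterates as backward orbits\<close>

lemma poly_iter_eval:
  "poly (ac_poly (poly_iter g n)) x = (poly (ac_poly g) ^^ n) x"
  unfolding poly_iter_def by (induction n) (simp_all add: poly_pcompose)

lemma ac_roots_P_iter:
  "ac_roots (P_iter f g n) = {x. (poly (ac_poly g) ^^ n) x \<in> ac_roots f}"
  unfolding P_iter_def by (simp add: poly_pcompose poly_iter_eval)

lemma ac_roots_P_iter_Suc:
  "ac_roots (P_iter f g (Suc n)) = poly (ac_poly g) -` ac_roots (P_iter f g n)"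
  unfolding ac_roots_P_iter by (auto simp: funpow_swap1)

lemma degree_P_iter:
  fixes f g :: "'a :: field poly"
  shows "Polynomial.degree (P_iter f g n) = Polynomial.degree f * Polynomial.degree g ^ n"
proof -
  have "Polynomial.degree (poly_iter g n) = Polynomial.degree g ^ n"
    unfolding poly_iter_def by (induction n) (simp_all add: degree_pcompose)
  thus ?thesis by (simp add: P_iter_def degree_pcompose)
qed

lemma
  fixes f g :: "'a :: field poly"
  assumes "Polynomial.degree f \<ge> 1" and "Polynomial.degree g \<ge> 1"
  shows finite_ac_roots_P_iter: "finite (ac_roots (P_iter f g n))"
    and ac_roots_P_iter_nonempty: "ac_roots (P_iter f g n) \<noteq> {}"
proof -
  have "Polynomial.degree (P_iter f g n) \<ge> 1"
    using assms by (simp add: degree_P_iter)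
  moreover from this have "P_iter f g n \<noteq> 0" by auto
  ultimately show "finite (ac_roots (P_iter f g n))" "ac_roots (P_iter f g n) \<noteq> {}"
    using finite_ac_roots ac_roots_nonempty by blast+
qed

lemma alg_degree_iterate_le:
  fixes g :: "'a :: finite_field poly"
  shows "alg_degree ((poly (ac_poly g) ^^ n) x) \<le> alg_degree x"
  using alg_degree_poly_le[of "poly_iter g n" x] by (simp add: poly_iter_eval)

section \<open>The largest degree\<close>

text \<open>
  The shift by \<open>2\<close> is the time after which there are certainly two roots. With only one
  root at times \<open>0\<close>, \<open>1\<close> and \<open>2\<close>, say \<open>a\<close>, \<open>b\<close> and \<open>c\<close>, the points \<open>a\<close> and
  \<open>b\<close> have no preimages but \<open>b\<close> and \<open>c\<close>. Two distinct points have at least three preimages, so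
  \<open>a = b\<close> and the pair is critical.
\<close>
lemma card_ac_roots_P_iter_ge:
  fixes f g :: "'a :: finite_field poly"
  assumes "Polynomial.degree f \<ge> 1" and "Polynomial.degree g \<ge> 2"
    and "\<not> critical f g" and "\<not> p_critical f g"
  shows "card (ac_roots (P_iter f g (n + 2))) \<ge> 2 ^ n + 1"
proof -
  define N where "N n = card (ac_roots (P_iter f g n))" for n
  have step: "2 * N n \<le> N (Suc n) + 1" for n
    unfolding N_def ac_roots_P_iter_Suc
    using assms(1,2) finite_ac_roots_P_iter[of f g n] ac_roots_P_iter_nonempty[of f g n]
    by (intro card_vimage_ge[OF assms(2,4)]) auto
  have pos: "N n \<ge> 1" for n
    unfolding N_def using assms finite_ac_roots_P_iter[of f g n] ac_roots_P_iter_nonempty[of f g n]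
    by (simp add: Suc_le_eq card_gt_0_iff)
  have two: "N 2 \<ge> 2"
  proof (rule ccontr)
    assume "\<not> N 2 \<ge> 2"
    hence "N 2 = 1" "N 1 = 1" "N 0 = 1"
      using pos[of 0] pos[of 1] pos[of 2] step[of 0] step[of 1] by (simp_all add: numeral_2_eq_2)
    then obtain a b c where abc: "ac_roots (P_iter f g 0) = {a}" "ac_roots (P_iter f g 1) = {b}"
        "ac_roots (P_iter f g 2) = {c}"
      unfolding N_def by (meson card_1_singletonE)
    have pre: "poly (ac_poly g) -` {a} = {b}" "poly (ac_poly g) -` {b} = {c}"
      using abc ac_roots_P_iter_Suc[of f g 0] ac_roots_P_iter_Suc[of f g 1]
      by (simp_all add: numeral_2_eq_2)
    have "a = b"
    proof (rule ccontr)
      assume "a \<noteq> b"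
      hence "2 * 2 \<le> card (poly (ac_poly g) -` {a, b}) + 1"
        using card_vimage_ge[OF assms(2,4), of "{a, b}"] by simp
      also have "poly (ac_poly g) -` {a, b} = {b, c}"
        using pre by (metis insert_is_Un vimage_Un)
      also have "card {b, c} \<le> 2" by (cases "b = c") auto
      finally show False by simp
    qed
    moreover have "ac_roots f = {a}" using abc(1) unfolding ac_roots_P_iter by simp
    ultimately have "critical f g"
      using pre(1) assms(1,2) by (intro unique_fixed_preimage_imp_critical) auto
    with assms(3) show False by contradiction
  qed
  have "N (n + 2) \<ge> 2 ^ n + 1"
  proof (induction n)
    case (Suc n)
    have "2 ^ Suc n + 2 \<le> 2 * N (n + 2)" using Suc.IH by simp
    also have "\<dots> \<le> N (Suc n + 2) + 1" using step[of "n + 2"] by simp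
    finally show ?case by simp
  qed (use two in \<open>simp add: numeral_2_eq_2\<close>)
  thus ?thesis unfolding N_def .
qed

text \<open>
  With \<open>q\<close> the number of field elements and \<open>M\<close> the largest degree, there are more than
  \<open>2^(n-2)\<close> and at most \<open>q^(M+1) M\<close> roots. The crude estimates \<open>M \<le> q^M\<close> and \<open>q \<le> 2^q\<close> turn this into
  \<open>n - 2 < 3 q M\<close> without logarithms.
\<close>
lemma M_deg_linear_lower_bound:
  fixes f g :: "'a :: finite_field poly"
  assumes "Polynomial.degree f \<ge> 1" and "Polynomial.degree g \<ge> 2"
    and "\<not> critical f g" and "\<not> p_critical f g"
  shows "n \<le> (3 * card (UNIV :: 'a set) + 2) * M_deg f g n"
proof -
  define q where "q = card (UNIV :: 'a set)"
  define M where "M = M_deg f g n"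
  have "card {0, 1 :: 'a} \<le> q" unfolding q_def by (rule card_mono) auto
  hence q: "q \<ge> 2" by simp
  have fin: "finite (ac_roots (P_iter f g n))" and ne: "ac_roots (P_iter f g n) \<noteq> {}"
    using finite_ac_roots_P_iter[of f g n] ac_roots_P_iter_nonempty[of f g n] assms(1,2) by auto
  have M: "M = Max (alg_degree ` ac_roots (P_iter f g n))"
    unfolding M_def M_deg_def irred_factor_degrees_eq ..
  hence sub: "ac_roots (P_iter f g n) \<subseteq> {x. alg_degree x \<le> M}"
    using fin by (auto intro!: Max_ge)
  moreover obtain x where "x \<in> ac_roots (P_iter f g n)" using ne by blast
  ultimately have M1: "M \<ge> 1" using alg_degree_pos[of x] by auto
  show ?thesis
  proof (cases "n < 2")
    case True
    thus ?thesis using M1 by (simp add: M_def[symmetric])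
  next
    case False
    have "2 ^ (n - 2) + 1 \<le> card (ac_roots (P_iter f g n))"
      using card_ac_roots_P_iter_ge[OF assms, of "n - 2"] False by (simp only: le_add_diff_inverse2 not_less)
    also have "\<dots> \<le> card {x :: 'a alg_closure. alg_degree x \<le> M}"
      using sub by (intro card_mono elements_of_bounded_degree)
    also have "\<dots> \<le> q ^ Suc M * M"
      unfolding q_def by (rule elements_of_bounded_degree)
    also have "\<dots> \<le> q ^ Suc M * q ^ M"
    proof (rule mult_le_mono2)
      have "M < 2 ^ M" by (rule less_exp)
      also have "\<dots> \<le> q ^ M" using q by (rule power_mono) simp
      finally show "M \<le> q ^ M" by simp
    qed
    also have "\<dots> = q ^ (2 * M + 1)" by (simp add: power_add mult_2)
    also have "\<dots> \<le> q ^ (3 * M)" using q M1 by (intro power_increasing) auto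
    also have "\<dots> \<le> (2 ^ q) ^ (3 * M)"
      using less_exp[of q] by (intro power_mono) auto
    also have "\<dots> = 2 ^ (q * (3 * M))" by (simp add: power_mult)
    finally have "(2 :: nat) ^ (n - 2) < 2 ^ (q * (3 * M))" by (simp only: Suc_eq_plus1[symmetric] Suc_le_eq)
    hence "n - 2 < q * (3 * M)" by (rule power_less_imp_less_exp[rotated]) simp
    hence "n \<le> 3 * q * M + 2 * M" using M1 by simp
    thus ?thesis by (simp add: M_def q_def algebra_simps)
  qed
qed

section \<open>The smallest degree\<close>

lemma m_deg_eq: "m_deg f g n = Min (alg_degree ` ac_roots (P_iter f g n))"
  by (simp add: m_deg_def irred_factor_degrees_eq)

lemma m_deg_le:
  assumes "Polynomial.degree f \<ge> 1" and "Polynomial.degree g \<ge> 1" and "x \<in> ac_roots (P_iter f g n)"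
  shows "m_deg f g n \<le> alg_degree x"
  unfolding m_deg_eq using assms finite_ac_roots_P_iter[of f g n] by (intro Min_le) auto

lemma m_deg_attained:
  assumes "Polynomial.degree f \<ge> 1" and "Polynomial.degree g \<ge> 1"
  obtains x where "x \<in> ac_roots (P_iter f g n)" and "m_deg f g n = alg_degree x"
proof -
  have "m_deg f g n \<in> alg_degree ` ac_roots (P_iter f g n)"
    unfolding m_deg_eq using finite_ac_roots_P_iter[OF assms] ac_roots_P_iter_nonempty[OF assms]
    by (intro Min_in) auto
  thus ?thesis using that by blast
qed

lemma incseq_m_deg:
  fixes f g :: "'a :: finite_field poly"
  assumes "Polynomial.degree f \<ge> 1" and "Polynomial.degree g \<ge> 1"
  shows "incseq (m_deg f g)"
proof (rule incseq_SucI)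
  fix n
  obtain x where x: "x \<in> ac_roots (P_iter f g (Suc n))" "m_deg f g (Suc n) = alg_degree x"
    using m_deg_attained[OF assms] .
  have "m_deg f g n \<le> alg_degree (poly (ac_poly g) x)"
    using x(1) unfolding ac_roots_P_iter_Suc by (intro m_deg_le assms) simp
  also have "\<dots> \<le> alg_degree x" by (rule alg_degree_poly_le)
  finally show "m_deg f g n \<le> m_deg f g (Suc n)" by (simp only: x(2))
qed

lemma bounded_incseq_nat_eventually_const:
  fixes u :: "nat \<Rightarrow> nat"
  assumes "incseq u" and "\<And>n. u n \<le> C"
  shows "\<exists>d. eventually (\<lambda>n. u n = d) sequentially"
proof -
  have fin: "finite (range u)" by (rule finite_subset[of _ "{..C}"]) (use assms(2) in auto)
  hence "Max (range u) \<in> range u" by (intro Max_in) auto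
  then obtain N where N: "Max (range u) = u N" by blast
  have "u n = u N" if "n \<ge> N" for n
    using incseqD[OF assms(1) that] Max_ge[OF fin, of "u n"] N by simp
  thus ?thesis unfolding eventually_sequentially by blast
qed

text \<open>
  Let \<open>T\<close> be the finite set of points of degree at most \<open>C\<close>, and let \<open>n\<close> be its size.
  A root of minimal degree at time \<open>n\<close> and its first \<open>n\<close> iterates are \<open>n + 1\<close> elements of \<open>T\<close>, so two of them coincide.
  From the first coincidence on the orbit is periodic, in particular at time \<open>n\<close>, where it is a root
  of \<open>f\<close>.
\<close>
lemma bounded_m_deg_imp_has_periodic_root:
  fixes f g :: "'a :: finite_field poly"
  assumes "Polynomial.degree f \<ge> 1" and "Polynomial.degree g \<ge> 1"
    and "\<And>n. m_deg f g n \<le> C"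
  shows "has_periodic_root f g"
proof -
  define G where "G = poly (ac_poly g)"
  define T where "T = {x :: 'a alg_closure. alg_degree x \<le> C}"
  have "finite T" unfolding T_def by (rule elements_of_bounded_degree)
  define n where "n = card T"
  obtain x where x: "x \<in> ac_roots (P_iter f g n)" "m_deg f g n = alg_degree x"
    using m_deg_attained[OF assms(1,2)] .
  have "alg_degree ((G ^^ i) x) \<le> C" for i
    using alg_degree_iterate_le[of i g x] assms(3)[of n] x(2) unfolding G_def by linarith
  hence "(\<lambda>i. (G ^^ i) x) ` {..n} \<subseteq> T" unfolding T_def by auto
  hence "card ((\<lambda>i. (G ^^ i) x) ` {..n}) \<le> n"
    unfolding n_def by (rule card_mono[OF \<open>finite T\<close>])
  hence "\<not> inj_on (\<lambda>i. (G ^^ i) x) {..n}" by (intro pigeonhole) simp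
  then obtain i j where ij: "i < j" "j \<le> n" "(G ^^ i) x = (G ^^ j) x"
    unfolding inj_on_def by (metis atMost_iff nat_neq_iff)
  have "(G ^^ (j - i)) ((G ^^ n) x) = (G ^^ (n - i)) ((G ^^ j) x)"
  proof -
    have "(j - i) + n = (n - i) + j" using ij by simp
    thus ?thesis by (metis comp_apply funpow_add)
  qed
  also have "\<dots> = (G ^^ (n - i)) ((G ^^ i) x)" by (simp only: ij(3))
  also have "\<dots> = (G ^^ n) x"
  proof -
    have "n = (n - i) + i" using ij by simp
    thus ?thesis by (metis comp_apply funpow_add)
  qed
  finally have "poly (ac_poly (poly_iter g (j - i))) ((G ^^ n) x) = (G ^^ n) x"
    by (simp add: poly_iter_eval G_def)
  moreover have "(G ^^ n) x \<in> ac_roots f" using x(1) unfolding ac_roots_P_iter G_def by simp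
  moreover have "j - i \<ge> 1" using ij(1) by simp
  ultimately show ?thesis unfolding has_periodic_root_def by blast
qed

lemma has_periodic_root_imp_bounded_m_deg:
  fixes f g :: "'a :: finite_field poly"
  assumes "Polynomial.degree f \<ge> 1" and "Polynomial.degree g \<ge> 1" and "has_periodic_root f g"
  obtains C where "\<And>n. m_deg f g n \<le> C"
proof -
  define G where "G = poly (ac_poly g)"
  obtain \<beta> i where \<beta>: "\<beta> \<in> ac_roots f" "i \<ge> 1" "(G ^^ i) \<beta> = \<beta>"
    using assms(3) unfolding has_periodic_root_def poly_iter_eval G_def by blast
  have "m_deg f g n \<le> alg_degree \<beta>" for n
  proof -
    \<comment> \<open>Going back \<open>n\<close> steps on a cycle whose length divides \<open>i\<close> is going forward
      \<open>i * n - n\<close> steps.\<close>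
    let ?x = "(G ^^ (i * n - n)) \<beta>"
    have "(G ^^ n) ?x = (G ^^ (i * n)) \<beta>"
    proof -
      have "n + (i * n - n) = i * n" using \<beta>(2) by simp
      thus ?thesis by (metis comp_apply funpow_add)
    qed
    also have "\<dots> = ((G ^^ i) ^^ n) \<beta>" by (simp add: funpow_mult)
    also have "\<dots> = \<beta>" by (induction n) (simp_all add: \<beta>(3))
    finally have "?x \<in> ac_roots (P_iter f g n)"
      using \<beta>(1) unfolding ac_roots_P_iter G_def by simp
    hence "m_deg f g n \<le> alg_degree ?x" by (rule m_deg_le[OF assms(1,2)])
    also have "\<dots> \<le> alg_degree \<beta>" unfolding G_def by (rule alg_degree_iterate_le)
    finally show ?thesis .
  qed
  thus ?thesis by (rule that)
qed

theorem theorem2p4: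
  fixes f g :: "'a :: finite_field poly"
  assumes "Polynomial.degree f \<ge> 1"
    and "Polynomial.degree g \<ge> 2"
    and "\<not> critical f g"
    and "\<not> p_critical f g"
  shows "(\<exists>c::real. c > 0 \<and> (\<forall>n\<ge>1. real (M_deg f g n) \<ge> c * real n)) \<and>
         ((\<exists>c::real. c > 0 \<and> (\<forall>n. real (m_deg f g n) \<le> c)) \<longleftrightarrow>
           (\<exists>d. eventually (\<lambda>n. m_deg f g n = d) sequentially)) \<and>
         ((\<exists>d. eventually (\<lambda>n. m_deg f g n = d) sequentially) \<longleftrightarrow>
           has_periodic_root f g)"
proof -
  let ?bounded = "\<exists>c::real. c > 0 \<and> (\<forall>n. real (m_deg f g n) \<le> c)"
  let ?const = "\<exists>d. eventually (\<lambda>n. m_deg f g n = d) sequentially"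
  have g1: "Polynomial.degree g \<ge> 1" using assms(2) by simp
  define K where "K = 3 * card (UNIV :: 'a set) + 2"
  have "1 / real K * real n \<le> real (M_deg f g n)" for n
  proof -
    have "real n \<le> real (K * M_deg f g n)"
      unfolding K_def using M_deg_linear_lower_bound[OF assms] by (rule of_nat_mono)
    thus ?thesis by (simp add: K_def field_simps)
  qed
  moreover have "1 / real K > 0" by (simp add: K_def)
  ultimately have M: "\<exists>c::real. c > 0 \<and> (\<forall>n\<ge>1. real (M_deg f g n) \<ge> c * real n)" by blast
  have mono: "incseq (m_deg f g)" using incseq_m_deg[OF assms(1) g1] .
  have const_imp_bounded: "?bounded" if ?const
  proof -
    from that obtain d N where N: "\<And>n. n \<ge> N \<Longrightarrow> m_deg f g n = d"
      unfolding eventually_sequentially by blast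
    have "m_deg f g n \<le> d" for n
      using incseqD[OF mono, of n "max n N"] N[of "max n N"] by simp
    thus ?thesis by (intro exI[of _ "real d + 1"]) (auto intro: order_trans[of _ "real d"])
  qed
  have bounded_imp_periodic: "has_periodic_root f g" if ?bounded
  proof -
    from that obtain c :: real where "\<And>n. real (m_deg f g n) \<le> c" by blast
    hence "m_deg f g n \<le> nat \<lfloor>c\<rfloor>" for n by (simp add: le_nat_floor)
    thus ?thesis by (rule bounded_m_deg_imp_has_periodic_root[OF assms(1) g1])
  qed
  have periodic_imp_const: "?const" if "has_periodic_root f g"
  proof -
    obtain C where "\<And>n. m_deg f g n \<le> C"
      using has_periodic_root_imp_bounded_m_deg[OF assms(1) g1 \<open>has_periodic_root f g\<close>] by blast
    thus ?thesis by (rule bounded_incseq_nat_eventually_const[OF mono])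
  qed
  from M const_imp_bounded bounded_imp_periodic periodic_imp_const show ?thesis by blast
qed

end
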